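(* Let $\mathcal{H}$ be a complex Hilbert space, let $A\in\mathcal{B}(\mathcal{H})$ be a positive operator, and let $T\in\mathcal{B}_A(\mathcal{H})$. Then $$w_A(T)=\sqrt{\frac{1}{4}\left\|T^{\sharp_A}T+TT^{\sharp_A}\right\|_A}$$ if and only if $$\|\Re_A(e^{\mathrm{i}\theta}T)\|_A^2=\|\Im_A(e^{\mathrm{i}\theta}T)\|_A^2=\frac{1}{4}\left\|T^{\sharp_A}T+TT^{\sharp_A}\right\|_A\quad\text{for all }\theta\in\mathbb{R}.$$
   Context: $\mathcal{B}(\mathcal{H})$ is the algebra of bounded linear operators on the complex Hilbert space $\mathcal{H}$ with inner product $\langle\cdot,\cdot\rangle$; $A\in\mathcal{B}(\mathcal{H})$ is positive (i.e. $\langle Ax,x\rangle\ge 0$ for all $x$), not necessarily injective. Put $\langle x,y\rangle_A=\langle Ax,y\rangle$ and $\|x\|_A=\sqrt{\langle x,x\rangle_A}$ (a seminorm on $\mathcal{H}$). $R(S)$ denotes the range of $S$ and $\overline{R(S)}$ its norm closure. $\mathcal{B}_A(\mathcal{H})=\{T\in\mathcal{B}(\mathcal{H}): R(T^*A)\subseteq R(A)\}$, equivalently the set of $T\in\mathcal{B}(\mathcal{H})$ for which there is $S\in\mathcal{B}(\mathcal{H})$ with $AS=T^*A$. For $T\in\mathcal{B}_A(\mathcal{H})$, $T^{\sharp_A}$ denotes the unique $X\in\mathcal{B}(\mathcal{H})$ with $AX=T^*A$ and $R(X)\subseteq\overline{R(A)}$. For $T\in\mathcal{B}_A(\mathcal{H})$: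 $\|T\|_A=\sup\{\|Tx\|_A: x\in\overline{R(A)},\ \|x\|_A=1\}=\sup\{\|Tx\|_A: x\in\mathcal{H},\ \|x\|_A=1\}$ (finite), and $w_A(T)=\sup\{|\langle Tx,x\rangle_A|: x\in\mathcal{H},\ \|x\|_A=1\}$. Finally $\Re_A(T)=\frac{T+T^{\sharp_A}}{2}$ and $\Im_A(T)=\frac{T-T^{\sharp_A}}{2\mathrm{i}}$. *)

theory Defs
  imports "HOL-Analysis.Analysis"
begin

text \<open>
  Complex Hilbert spaces as a type class on top of \<open>banach\<close>. The inner product is linear in its
  first argument and conjugate-linear in the second.
\<close>

class complex_hilbert = banach +
  fixes scaleC :: "complex \<Rightarrow> 'a \<Rightarrow> 'a"  (infixr "*\<^sub>C" 75)
    and cinner :: "'a \<Rightarrow> 'a \<Rightarrow> complex"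
  assumes scaleC_add_right: "c *\<^sub>C (x + y) = c *\<^sub>C x + c *\<^sub>C y"
    and scaleC_add_left: "(c + d) *\<^sub>C x = c *\<^sub>C x + d *\<^sub>C x"
    and scaleC_scaleC: "c *\<^sub>C d *\<^sub>C x = (c * d) *\<^sub>C x"
    and scaleC_one: "1 *\<^sub>C x = x"
    and scaleR_scaleC: "r *\<^sub>R x = complex_of_real r *\<^sub>C x"
    and cinner_add_left: "cinner (x + y) z = cinner x z + cinner y z"
    and cinner_scaleC_left: "cinner (c *\<^sub>C x) y = c * cinner x y"
    and cinner_commute: "cinner x y = cnj (cinner y x)"
    and cinner_self_nonneg: "cinner x x \<in> \<real>\<^sub>\<ge>\<^sub>0"
    and cinner_self_eq_zero: "cinner x x = 0 \<longleftrightarrow> x = 0"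
    and norm_eq_sqrt_cinner: "norm x = sqrt (Re (cinner x x))"

definition bounded_clinear :: "('a::complex_hilbert \<Rightarrow> 'a) \<Rightarrow> bool" where
  "bounded_clinear T \<longleftrightarrow> bounded_linear T \<and> (\<forall>c x. T (c *\<^sub>C x) = c *\<^sub>C T x)"

definition cadjoint :: "('a::complex_hilbert \<Rightarrow> 'a) \<Rightarrow> 'a \<Rightarrow> 'a" where
  "cadjoint T = (THE S. bounded_clinear S \<and> (\<forall>x y. cinner (T x) y = cinner x (S y)))"

definition positive_op :: "('a::complex_hilbert \<Rightarrow> 'a) \<Rightarrow> bool" where
  "positive_op A \<longleftrightarrow> bounded_clinear A \<and> (\<forall>x. cinner (A x) x \<in> \<real>\<^sub>\<ge>\<^sub>0)"

definition A_inner :: "('a::complex_hilbert \<Rightarrow> 'a) \<Rightarrow> 'a \<Rightarrow> 'a \<Rightarrow> complex" where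
  "A_inner A x y = cinner (A x) y"

definition A_seminorm :: "('a::complex_hilbert \<Rightarrow> 'a) \<Rightarrow> 'a \<Rightarrow> real" where
  "A_seminorm A x = sqrt (Re (A_inner A x x))"

definition A_adjointable :: "('a::complex_hilbert \<Rightarrow> 'a) \<Rightarrow> ('a \<Rightarrow> 'a) set" where
  "A_adjointable A = {T. bounded_clinear T \<and> range (cadjoint T \<circ> A) \<subseteq> range A}"

definition A_sharp :: "('a::complex_hilbert \<Rightarrow> 'a) \<Rightarrow> ('a \<Rightarrow> 'a) \<Rightarrow> 'a \<Rightarrow> 'a" where
  "A_sharp A T = (THE X. bounded_clinear X \<and> A \<circ> X = cadjoint T \<circ> A \<and>
                         range X \<subseteq> closure (range A))"

text \<open>
  The two suprema below are taken in \<open>[0, \<infinity>)\<close>. Inserting \<open>0\<close> only matters for \<open>A = 0\<close>, where no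
  \<open>x\<close> has \<open>A\<close>-seminorm \<open>1\<close> and \<open>Sup {}\<close> would be an unspecified real; the value is then \<open>0\<close>.
\<close>

definition A_norm :: "('a::complex_hilbert \<Rightarrow> 'a) \<Rightarrow> ('a \<Rightarrow> 'a) \<Rightarrow> real" where
  "A_norm A T =
     Sup (insert 0 {A_seminorm A (T x) | x. x \<in> closure (range A) \<and> A_seminorm A x = 1})"

definition A_numerical_radius :: "('a::complex_hilbert \<Rightarrow> 'a) \<Rightarrow> ('a \<Rightarrow> 'a) \<Rightarrow> real" where
  "A_numerical_radius A T =
     Sup (insert 0 {cmod (A_inner A (T x) x) | x. A_seminorm A x = 1})"

definition A_Re :: "('a::complex_hilbert \<Rightarrow> 'a) \<Rightarrow> ('a \<Rightarrow> 'a) \<Rightarrow> 'a \<Rightarrow> 'a" where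
  "A_Re A T = (\<lambda>x. (1 / 2) *\<^sub>C (T x + A_sharp A T x))"

definition A_Im :: "('a::complex_hilbert \<Rightarrow> 'a) \<Rightarrow> ('a \<Rightarrow> 'a) \<Rightarrow> 'a \<Rightarrow> 'a" where
  "A_Im A T = (\<lambda>x. (1 / (2 * \<i>)) *\<^sub>C (T x - A_sharp A T x))"

end

theory Submission
  imports Defs
begin

text \<open>
  Put \<open>R\<^sub>u = (u T + cnj u T\<^sup>\<sharp>) / 2\<close> for \<open>cmod u = 1\<close>. This operator is self-adjoint for the
  semi-inner product of \<open>A\<close>, so its seminorm is the supremum of
  \<open>\<bar>Re (u \<langle>T x, x\<rangle>\<^sub>A)\<bar>\<close> over \<open>A\<close>-unit vectors, and \<open>w\<^sub>A(T) = sup \<parallel>R\<^sub>u\<parallel>\<^sub>A\<close>. The operators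
  \<open>\<Re>\<^sub>A(u T)\<close> and \<open>\<Im>\<^sub>A(u T)\<close> are \<open>R\<^sub>u\<close> and \<open>R\<^sub>v\<close> for \<open>v = - \<i> u\<close>, and
  \<open>T\<^sup>\<sharp> T + T T\<^sup>\<sharp> = 2 (R\<^sub>u R\<^sub>u + R\<^sub>v R\<^sub>v)\<close> has seminorm at most
  \<open>2 (\<parallel>R\<^sub>u\<parallel>\<^sup>2 + \<parallel>R\<^sub>v\<parallel>\<^sup>2)\<close>. If \<open>4 w\<^sub>A(T)\<^sup>2\<close> equals that seminorm, then both squares, which are at
  most \<open>w\<^sub>A(T)\<^sup>2\<close>, must be equal to it; the converse is the formula for \<open>w\<^sub>A(T)\<close>.

  The existence of \<open>T\<^sup>\<sharp>\<close> needs the Riesz representation theorem and Douglas' range inclusion lemma,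
  and the finiteness of the suprema needs a spectral bound for self-adjoint operators on a
  seminormed space.
\<close>

section \<open>Semi-inner products\<close>

lemma scaleC_zero_right [simp]: "c *\<^sub>C (0 :: 'a::complex_hilbert) = 0"
  using scaleC_add_right[of c "0 :: 'a" 0] by simp

lemma scaleC_minus_right: "c *\<^sub>C (- x) = - (c *\<^sub>C (x :: 'a::complex_hilbert))"
  using scaleC_add_right[of c x "- x"] by (simp add: eq_neg_iff_add_eq_0 add.commute)

lemma scaleC_diff_right: "c *\<^sub>C (x - y) = c *\<^sub>C x - c *\<^sub>C (y :: 'a::complex_hilbert)"
  using scaleC_add_right[of c x "- y"] by (simp add: scaleC_minus_right)

lemma scaleC_minus_left: "(- c) *\<^sub>C x = - (c *\<^sub>C (x :: 'a::complex_hilbert))"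
proof -
  have "(- 1) *\<^sub>C x = - x" for x :: 'a
    using scaleR_scaleC[of "- 1" x] by simp
  then show ?thesis
    using scaleC_scaleC[of "- 1" c x] by simp
qed

locale semi_inner =
  fixes ip :: "'a::complex_hilbert \<Rightarrow> 'a \<Rightarrow> complex"
  assumes add_left: "ip (x + y) z = ip x z + ip y z"
    and scaleC_left: "ip (c *\<^sub>C x) y = c * ip x y"
    and commute: "ip x y = cnj (ip y x)"
    and self_nonneg: "ip x x \<in> \<real>\<^sub>\<ge>\<^sub>0"
begin

definition sn :: "'a \<Rightarrow> real" where "sn x = sqrt (Re (ip x x))"

lemma add_right: "ip x (y + z) = ip x y + ip x z"
  by (metis add_left commute complex_cnj_add)

lemma scaleC_right: "ip x (c *\<^sub>C y) = cnj c * ip x y"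
  by (metis scaleC_left commute complex_cnj_mult)

lemma scaleR_left: "ip (r *\<^sub>R x) y = of_real r * ip x y"
  by (simp add: scaleR_scaleC scaleC_left)

lemma scaleR_right: "ip x (r *\<^sub>R y) = of_real r * ip x y"
  by (simp add: scaleR_scaleC scaleC_right)

lemma minus_left: "ip (- x) y = - ip x y"
  using scaleR_left[of "- 1" x y] by simp

lemma minus_right: "ip x (- y) = - ip x y"
  using scaleR_right[of x "- 1" y] by simp

lemma diff_left: "ip (x - y) z = ip x z - ip y z"
  using add_left[of x "- y" z] by (simp add: minus_left)

lemma diff_right: "ip x (y - z) = ip x y - ip x z"
  using add_right[of x y "- z"] by (simp add: minus_right)

lemma zero_left [simp]: "ip 0 y = 0"
  using diff_left[of 0 0 y] by simp

lemma zero_right [simp]: "ip x 0 = 0"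
  using diff_right[of x 0 0] by simp

lemma Re_self_nonneg: "0 \<le> Re (ip x x)" and Im_self: "Im (ip x x) = 0"
  using self_nonneg[of x] by (auto simp: complex_nonneg_Reals_iff)

lemma sn_nonneg [simp]: "0 \<le> sn x"
  by (simp add: sn_def Re_self_nonneg)

lemma sn_sq: "(sn x)\<^sup>2 = Re (ip x x)"
  by (simp add: sn_def Re_self_nonneg)

lemma ip_self: "ip x x = of_real ((sn x)\<^sup>2)"
  by (simp add: sn_sq complex_eq_iff Im_self)

lemma sn_scaleC: "sn (c *\<^sub>C x) = cmod c * sn x"
proof -
  have "(sn (c *\<^sub>C x))\<^sup>2 = Re ((c * cnj c) * ip x x)"
    by (simp add: sn_sq scaleC_left scaleC_right algebra_simps)
  also have "\<dots> = (cmod c * sn x)\<^sup>2"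
    unfolding complex_norm_square[symmetric] ip_self
    by (simp add: power_mult_distrib flip: of_real_power of_real_mult)
  finally show ?thesis
    by (simp add: power2_eq_iff_nonneg)
qed

lemma sn_scaleR: "sn (r *\<^sub>R x) = \<bar>r\<bar> * sn x"
  by (simp add: scaleR_scaleC sn_scaleC)

lemma sn_minus: "sn (- x) = sn x"
  using sn_scaleR[of "- 1" x] by simp

lemma Re_commute: "Re (ip y x) = Re (ip x y)"
  by (subst commute) simp

lemma sn_add_sq: "(sn (x + y))\<^sup>2 = (sn x)\<^sup>2 + 2 * Re (ip x y) + (sn y)\<^sup>2"
  by (simp add: sn_sq add_left add_right Re_commute[of y x])

lemma sn_diff_sq: "(sn (x - y))\<^sup>2 = (sn x)\<^sup>2 - 2 * Re (ip x y) + (sn y)\<^sup>2"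
  by (simp add: sn_sq diff_left diff_right Re_commute[of y x])

lemma parallelogram: "(sn (x + y))\<^sup>2 + (sn (x - y))\<^sup>2 = 2 * (sn x)\<^sup>2 + 2 * (sn y)\<^sup>2"
  by (simp add: sn_add_sq sn_diff_sq)

text \<open>A null vector can be nonzero, so Cauchy-Schwarz needs this degenerate case. Expanding
  \<open>(sn (x - t *\<^sub>R y))\<^sup>2\<close> leaves an expression affine in t that stays
  nonnegative for every real t, which rules out a positive real part.\<close>

lemma Re_ip_le_0: "Re (ip x y) \<le> 0" if "sn y = 0"
proof (rule ccontr)
  assume neg: "\<not> Re (ip x y) \<le> 0"
  have "2 * (t * Re (ip x y)) \<le> (sn x)\<^sup>2" for t
    using sn_diff_sq[of x "t *\<^sub>R y"] that zero_le_power2[of "sn (x - t *\<^sub>R y)"]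
    by (simp add: scaleR_right sn_scaleR)
  from this[of "((sn x)\<^sup>2 + 1) / Re (ip x y)"] show False
    using neg zero_le_power2[of "sn x"] by simp
qed

lemma Re_ip_le: "Re (ip x y) \<le> sn x * sn y"
proof (cases "sn x = 0 \<or> sn y = 0")
  case True
  then show ?thesis
    using Re_ip_le_0[of x y] Re_ip_le_0[of y x] by (auto simp: Re_commute)
next
  case False
  then have pos: "0 < sn x" "0 < sn y" by (auto simp: less_le)
  have "0 \<le> (sn (sn y *\<^sub>R x - sn x *\<^sub>R y))\<^sup>2" by simp
  also have "\<dots> = 2 * (sn x * sn y) * (sn x * sn y - Re (ip x y))"
    unfolding sn_diff_sq
    by (simp add: scaleR_left scaleR_right sn_scaleR power2_eq_square algebra_simps)
  finally show ?thesis
    using mult_pos_pos[OF pos] by (simp add: zero_le_mult_iff)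
qed

lemma Cauchy_Schwarz: "cmod (ip x y) \<le> sn x * sn y"
proof (cases "ip x y = 0")
  case False
  \<comment> \<open>The unimodular \<open>c\<close> rotates \<open>ip x y\<close> onto its modulus,
    reducing the claim to the bound on real parts.\<close>
  define c where "c = cnj (ip x y) / cmod (ip x y)"
  have c: "cmod c = 1" using False by (simp add: c_def norm_divide)
  have "c * ip x y = of_real (cmod (ip x y))"
    using False by (simp add: c_def complex_norm_square mult.commute field_simps power2_eq_square
      flip: complex_norm_square)
  then have "cmod (ip x y) = Re (ip (c *\<^sub>C x) y)"
    by (simp add: scaleC_left)
  also have "\<dots> \<le> sn x * sn y"
    using Re_ip_le[of "c *\<^sub>C x" y] by (simp add: sn_scaleC c)
  finally show ?thesis .
qed simp

lemma triangle: "sn (x + y) \<le> sn x + sn y"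
proof (rule power2_le_imp_le)
  show "(sn (x + y))\<^sup>2 \<le> (sn x + sn y)\<^sup>2"
    using Re_ip_le[of x y] by (simp add: sn_add_sq power2_sum)
qed simp

section \<open>Seminorm bounds for symmetric operators\<close>

text \<open>For a symmetric operator the quadratic form controls the seminorm: polarization and the
  parallelogram law turn the bound on the form into one on \<open>ip (R x) y\<close>, which is then
  tested on a multiple of \<open>R x\<close>.\<close>

lemma sn_symmetric_le:
  assumes add: "\<And>x y. R (x + y) = R x + R y"
    and sym: "\<And>x y. ip (R x) y = ip x (R y)"
    and c: "\<And>x. cmod (ip (R x) x) \<le> c * (sn x)\<^sup>2"
  shows "sn (R x) \<le> c * sn x"
proof -
  have R_diff: "R (x - y) = R x - R y" for x y
    using add[of "x - y" y] by simp
  have polar: "2 * Re (ip (R x) y) \<le> c * ((sn x)\<^sup>2 + (sn y)\<^sup>2)" for x y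
  proof -
    have "Re (ip (R y) x) = Re (ip (R x) y)"
      by (simp add: sym[of y x] Re_commute)
    then have "4 * Re (ip (R x) y) = Re (ip (R (x + y)) (x + y)) - Re (ip (R (x - y)) (x - y))"
      by (simp add: add R_diff add_left add_right diff_left diff_right)
    also have "\<dots> \<le> c * (sn (x + y))\<^sup>2 + c * (sn (x - y))\<^sup>2"
      using c[of "x + y"] c[of "x - y"] abs_Re_le_cmod[of "ip (R (x + y)) (x + y)"]
        abs_Re_le_cmod[of "ip (R (x - y)) (x - y)"] by linarith
    also have "\<dots> = 2 * (c * ((sn x)\<^sup>2 + (sn y)\<^sup>2))"
      using arg_cong[OF parallelogram[of x y], of "\<lambda>t. c * t"] by (simp add: algebra_simps)
    finally show ?thesis by simp
  qed
  show ?thesis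
  proof (cases "sn (R x) = 0 \<or> sn x = 0")
    \<comment> \<open>The sign of \<open>c\<close> is forced only if some vector has positive
      seminorm. If x is null, so is \<open>R x\<close>, because symmetry gives
      \<open>(sn (R x))\<^sup>2 = Re (ip x (R (R x)))\<close>.\<close>
    case True
    have "0 \<le> c * sn x"
    proof (cases "sn x = 0")
      case False
      then have "0 < (sn x)\<^sup>2" by simp
      moreover have "0 \<le> c * (sn x)\<^sup>2" using c[of x] norm_ge_zero order_trans by blast
      ultimately have "0 \<le> c" by (simp add: zero_le_mult_iff)
      then show ?thesis by simp
    qed simp
    moreover have "sn (R x) = 0" if "sn x = 0"
    proof -
      have "(sn (R x))\<^sup>2 = Re (ip x (R (R x)))" by (simp add: sn_sq sym)
      also have "\<dots> \<le> 0" using Re_ip_le[of x "R (R x)"] that by simp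
      finally show ?thesis by simp
    qed
    ultimately show ?thesis using True by auto
  next
    case False
    then have pos: "0 < sn (R x)" "0 < sn x"
      by (auto simp: less_le)
    \<comment> \<open>This scaling gives \<open>t *\<^sub>R R x\<close> the same seminorm as x, so
      both summands on the right of \<open>polar\<close> coincide.\<close>
    define t where "t = sn x / sn (R x)"
    have t: "0 < t" "t * sn (R x) = sn x" using pos by (auto simp: t_def)
    have "2 * (t * (sn (R x))\<^sup>2) \<le> c * (2 * (sn x)\<^sup>2)"
      using polar[of x "t *\<^sub>R R x"] t by (simp add: scaleR_right sn_scaleR sn_sq)
    also have "2 * (t * (sn (R x))\<^sup>2) = 2 * (sn x * sn (R x))"
      using t by (simp add: power2_eq_square flip: mult.assoc)
    finally have "sn x * sn (R x) \<le> sn x * (c * sn x)"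
      by (simp add: power2_eq_square mult_ac)
    then show ?thesis using pos by simp
  qed
qed

text \<open>Iterating \<open>(sn (B x))\<^sup>2 \<le> sn x * sn (B (B x))\<close> gives \<open>sn (B x) ^ n \<le> sn ((B ^^ n) x)\<close> for
  \<open>sn x = 1\<close>, while the right-hand side is at most \<open>K * M ^ n * norm x\<close>.\<close>

lemma sn_symmetric_bounded:
  assumes scale: "\<And>r x. B (r *\<^sub>R x) = r *\<^sub>R B x"
    and sym: "\<And>x y. ip (B x) y = ip x (B y)"
    and K: "\<And>x. sn x \<le> K * norm x"
    and M: "\<And>x. norm (B x) \<le> M * norm x" "0 \<le> M" "0 \<le> K"
  shows "sn (B x) \<le> M * sn x"
proof -
  have sq: "(sn (B x))\<^sup>2 \<le> sn x * sn (B (B x))" for x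
    using Re_ip_le[of x "B (B x)"] by (simp add: sn_sq sym)
  have unit: "sn (B x) \<le> M" if x: "sn x = 1" for x
  proof (rule ccontr)
    assume "\<not> sn (B x) \<le> M"
    then have gt: "M < sn (B x)" by simp
    define a where "a n = sn ((B ^^ n) x)" for n
    define b where "b = sn (B x)"
    have b: "0 < b" using gt M(2) by (simp add: b_def)
    \<comment> \<open>By \<open>sq\<close> the sequence \<open>a\<close> is log-convex, so its
      successive ratios never fall below the first one, \<open>b\<close>. Positivity is carried
      along so that \<open>a n\<close> can be cancelled.\<close>
    have step: "b * a n \<le> a (Suc n) \<and> 0 < a n" for n
    proof (induction n)
      case 0
      show ?case by (simp add: a_def b_def x)
    next
      case (Suc n)
      have pos: "0 < a (Suc n)" using Suc b by (meson less_le_trans mult_pos_pos)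
      have "a n * (b * a (Suc n)) = (b * a n) * a (Suc n)" by simp
      also have "\<dots> \<le> a (Suc n) * a (Suc n)" using Suc pos by (intro mult_right_mono) auto
      also have "\<dots> \<le> a n * a (Suc (Suc n))"
        using sq[of "(B ^^ n) x"] by (simp add: a_def power2_eq_square)
      finally show ?case using Suc pos by simp
    qed
    have low: "b ^ n \<le> a n" for n
    proof (induction n)
      case (Suc n)
      have "b ^ Suc n \<le> b * a n" using Suc b by simp
      then show ?case using step[of n] by linarith
    qed (simp add: a_def x)
    have "norm ((B ^^ n) x) \<le> M ^ n * norm x" for n
    proof (induction n)
      case (Suc n)
      have "norm ((B ^^ Suc n) x) \<le> M * norm ((B ^^ n) x)" using M(1) by simp
      also have "\<dots> \<le> M * (M ^ n * norm x)" using Suc M(2) by (intro mult_left_mono)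
      finally show ?case by (simp add: mult_ac)
    qed simp
    then have up: "a n \<le> K * (M ^ n * norm x)" for n
      unfolding a_def by (rule order_trans[OF K mult_left_mono]) (simp add: M(3))
    \<comment> \<open>As \<open>M < b\<close>, these terms tend to 0, while \<open>low\<close> and
      \<open>up\<close> together keep them at least 1.\<close>
    have "(\<lambda>n. (M / b) ^ n * (K * norm x)) \<longlonglongrightarrow> 0 * (K * norm x)"
      using gt M(2) b by (intro tendsto_mult tendsto_const LIMSEQ_power_zero) (simp add: b_def)
    moreover have "1 \<le> (M / b) ^ n * (K * norm x)" for n
      using order_trans[OF low up, of n] b by (simp add: power_divide field_simps)
    ultimately show False
      using LIMSEQ_le_const[of "\<lambda>n. (M / b) ^ n * (K * norm x)" 0 1] by auto
  qed
  show ?thesis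
  proof (cases "sn x = 0")
    case True
    then show ?thesis using sq[of x] by simp
  next
    case False
    then have pos: "0 < sn x" by (simp add: less_le)
    then have "sn ((1 / sn x) *\<^sub>R x) = 1" by (simp add: sn_scaleR)
    from unit[OF this] show ?thesis
      using pos by (simp add: scale sn_scaleR field_simps)
  qed
qed

end

text \<open>With the rewrite, every fact on semi-inner products becomes a fact about the Hilbert
  space norm; the same locale later serves \<open>A_inner A\<close>.\<close>

global_interpretation cinner: semi_inner cinner
  rewrites "cinner.sn = norm"
proof -
  show *: "semi_inner (cinner :: 'a \<Rightarrow> 'a \<Rightarrow> complex)"
    by unfold_locales (fact cinner_add_left cinner_scaleC_left cinner_commute cinner_self_nonneg)+
  show "semi_inner.sn (cinner :: 'a \<Rightarrow> 'a \<Rightarrow> complex) = norm"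
    by (rule ext) (simp add: semi_inner.sn_def[OF *] norm_eq_sqrt_cinner)
qed

section \<open>Projections, Riesz representation and adjoints\<close>

lemma bounded_linear_cinner_left: "bounded_linear (\<lambda>x. cinner x y)"
  by (rule bounded_linear_intro[where K = "norm y"])
    (simp_all add: cinner.add_left cinner.scaleR_left scaleR_conv_of_real cinner.Cauchy_Schwarz)

lemma bounded_linear_cinner_right: "bounded_linear (\<lambda>y. cinner x y)"
  by (rule bounded_linear_intro[where K = "norm x"])
    (simp_all add: cinner.add_right cinner.scaleR_right scaleR_conv_of_real
      cinner.Cauchy_Schwarz mult.commute[of _ "norm x"])

lemma bounded_linear_scaleC: "bounded_linear (\<lambda>x :: 'a::complex_hilbert. c *\<^sub>C x)"
  by (rule bounded_linear_intro[where K = "cmod c"])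
    (simp_all add: scaleC_add_right scaleR_scaleC scaleC_scaleC cinner.sn_scaleC mult.commute)

lemma bounded_clinearI:
  assumes "\<And>x y. T (x + y) = T x + T y" "\<And>c x. T (c *\<^sub>C x) = c *\<^sub>C T x"
    and "\<And>x. norm (T x) \<le> K * norm x"
  shows "bounded_clinear T"
  unfolding bounded_clinear_def
  by (intro conjI allI bounded_linear_intro[where K = K] assms)
    (simp_all add: scaleR_scaleC assms mult.commute)

lemma bounded_clinearD:
  assumes "bounded_clinear T"
  shows "bounded_linear T" "T (x + y) = T x + T y" "T (x - y) = T x - T y" "T (- x) = - T x"
    "T 0 = 0" "T (c *\<^sub>C x) = c *\<^sub>C T x" "T (r *\<^sub>R x) = r *\<^sub>R T x"
proof -
  show T: "bounded_linear T" and "T (c *\<^sub>C x) = c *\<^sub>C T x"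
    using assms by (auto simp: bounded_clinear_def)
  interpret bounded_linear T by (fact T)
  show "T (x + y) = T x + T y" "T (x - y) = T x - T y" "T (- x) = - T x"
    "T 0 = 0" "T (r *\<^sub>R x) = r *\<^sub>R T x"
    by (simp_all add: add diff neg zero scaleR)
qed

lemma bounded_clinear_add:
  "bounded_clinear S \<Longrightarrow> bounded_clinear T \<Longrightarrow> bounded_clinear (\<lambda>x. S x + T x)"
  unfolding bounded_clinear_def by (auto intro: bounded_linear_add simp: scaleC_add_right)

lemma bounded_clinear_comp:
  "bounded_clinear S \<Longrightarrow> bounded_clinear T \<Longrightarrow> bounded_clinear (\<lambda>x. S (T x))"
  unfolding bounded_clinear_def by (auto intro: bounded_linear_compose)

lemma bounded_clinear_scaleC:
  "bounded_clinear T \<Longrightarrow> bounded_clinear (\<lambda>x. c *\<^sub>C T x)"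
  unfolding bounded_clinear_def
  by (auto intro: bounded_linear_compose[OF bounded_linear_scaleC] simp: scaleC_scaleC mult.commute)

lemma bounded_clinear_bound:
  assumes "bounded_clinear T"
  obtains K where "0 \<le> K" "\<And>x. norm (T x) \<le> K * norm x"
  using bounded_linear.nonneg_bounded[OF bounded_clinearD(1)[OF assms]] by (metis mult.commute)

section \<open>Closed subspaces and orthogonal projection\<close>

definition csubspace :: "'a::complex_hilbert set \<Rightarrow> bool" where
  "csubspace M \<longleftrightarrow> 0 \<in> M \<and> (\<forall>x\<in>M. \<forall>y\<in>M. x + y \<in> M) \<and> (\<forall>c. \<forall>x\<in>M. c *\<^sub>C x \<in> M)"

lemma csubspaceD:
  assumes "csubspace M"
  shows "0 \<in> M" "x \<in> M \<Longrightarrow> y \<in> M \<Longrightarrow> x + y \<in> M" "x \<in> M \<Longrightarrow> c *\<^sub>C x \<in> M"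
    "x \<in> M \<Longrightarrow> r *\<^sub>R x \<in> M" "x \<in> M \<Longrightarrow> y \<in> M \<Longrightarrow> x - y \<in> M"
proof -
  show *: "0 \<in> M" "x \<in> M \<Longrightarrow> y \<in> M \<Longrightarrow> x + y \<in> M" "x \<in> M \<Longrightarrow> c *\<^sub>C x \<in> M"
    and "x \<in> M \<Longrightarrow> r *\<^sub>R x \<in> M" for x y c
    using assms by (auto simp: csubspace_def scaleR_scaleC)
  show "x - y \<in> M" if "x \<in> M" "y \<in> M"
    using *(2)[OF that(1) *(3)[OF that(2), of "- 1"]]
    by (simp add: scaleC_minus_left scaleC_one)
qed

lemma csubspace_closure:
  assumes "csubspace M"
  shows "csubspace (closure M)"
  unfolding csubspace_def
proof (intro conjI ballI allI)
  show "0 \<in> closure M"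
    using csubspaceD(1)[OF assms] closure_subset by blast
next
  fix x y assume "x \<in> closure M" "y \<in> closure M"
  then obtain f g where fg: "\<And>n. f n \<in> M" "f \<longlonglongrightarrow> x" "\<And>n. g n \<in> M" "g \<longlonglongrightarrow> y"
    unfolding closure_sequential by blast
  then have "\<And>n. f n + g n \<in> M" "(\<lambda>n. f n + g n) \<longlonglongrightarrow> x + y"
    using csubspaceD(2)[OF assms] by (auto intro: tendsto_add)
  then show "x + y \<in> closure M"
    unfolding closure_sequential by (intro exI[of _ "\<lambda>n. f n + g n"]) auto
next
  fix c x assume "x \<in> closure M"
  then obtain f where f: "\<And>n. f n \<in> M" "f \<longlonglongrightarrow> x"
    unfolding closure_sequential by blast
  then have "\<And>n. c *\<^sub>C f n \<in> M" "(\<lambda>n. c *\<^sub>C f n) \<longlonglongrightarrow> c *\<^sub>C x"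
    using csubspaceD(3)[OF assms] bounded_linear.tendsto[OF bounded_linear_scaleC] by auto
  then show "c *\<^sub>C x \<in> closure M"
    unfolding closure_sequential by (intro exI[of _ "\<lambda>n. c *\<^sub>C f n"]) auto
qed

lemma csubspace_range:
  assumes "bounded_clinear T"
  shows "csubspace (range T)"
proof -
  note T = bounded_clinearD[OF assms]
  have "0 \<in> range T" by (metis T(5) rangeI)
  then show ?thesis
    unfolding csubspace_def by (auto simp flip: T(2,6))
qed

text \<open>The sets of near-minimizers are closed, nonempty and nested, and the parallelogram law
  makes their diameters shrink to 0; completeness then gives a common point.\<close>

lemma closest_point_exists:
  fixes M :: "'a::complex_hilbert set"
  assumes "closed M" "csubspace M"
  obtains p where "p \<in> M" "\<And>m. m \<in> M \<Longrightarrow> norm (x - p) \<le> norm (x - m)"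
proof -
  define d where "d = (INF m\<in>M. (norm (x - m))\<^sup>2)"
  have bdd: "bdd_below ((\<lambda>m. (norm (x - m))\<^sup>2) ` M)"
    by (rule bdd_belowI[of _ 0]) auto
  have ne: "M \<noteq> {}" using csubspaceD(1)[OF assms(2)] by auto
  have d: "d \<le> (norm (x - m))\<^sup>2" if "m \<in> M" for m
    unfolding d_def using bdd that by (rule cINF_lower)
  define S where "S n = {m \<in> M. (norm (x - m))\<^sup>2 \<le> d + 1 / real (Suc n)}" for n
  have "closed (S n)" for n
  proof -
    have "S n = M \<inter> {m. (norm (x - m))\<^sup>2 \<le> d + 1 / real (Suc n)}" by (auto simp: S_def)
    moreover have "closed {m. (norm (x - m))\<^sup>2 \<le> d + 1 / real (Suc n)}"
      by (intro closed_Collect_le continuous_intros)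
    ultimately show ?thesis using assms(1) by auto
  qed
  moreover have "S n \<noteq> {}" for n
  proof -
    have "\<exists>m\<in>M. (norm (x - m))\<^sup>2 < d + 1 / real (Suc n)"
      using cINF_less_iff[OF ne bdd, of "d + 1 / real (Suc n)"] by (simp add: d_def)
    then show ?thesis by (force simp: S_def)
  qed
  moreover have "S n \<subseteq> S m" if "m \<le> n" for m n
  proof -
    have "1 / real (Suc n) \<le> 1 / real (Suc m)" using that by (simp add: field_simps)
    then show ?thesis by (force simp: S_def)
  qed
  moreover have "\<exists>n. \<forall>u\<in>S n. \<forall>v\<in>S n. dist u v < e" if "0 < e" for e
  proof -
    obtain n where n: "4 / e\<^sup>2 < real n" using reals_Archimedean2 by blast
    have "dist u v < e" if uv: "u \<in> S n" "v \<in> S n" for u v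
    proof -
      \<comment> \<open>The midpoint stays in \<open>M\<close>, so its squared distance to x is at
        least \<open>d\<close>; this is what keeps u and v close to each other.\<close>
      have "(1 / 2) *\<^sub>R (u + v) \<in> M"
        using uv csubspaceD(2,4)[OF assms(2)] by (auto simp: S_def)
      from d[OF this] have "4 * d \<le> (norm (2 *\<^sub>R (x - (1 / 2) *\<^sub>R (u + v))))\<^sup>2"
        by (simp only: norm_scaleR power_mult_distrib) simp
      also have "2 *\<^sub>R (x - (1 / 2) *\<^sub>R (u + v)) = (x - u) + (x - v)"
        by (simp add: scaleR_diff_right scaleR_2)
      finally have "(norm ((x - u) - (x - v)))\<^sup>2 \<le> 2 * (norm (x - u))\<^sup>2 + 2 * (norm (x - v))\<^sup>2 - 4 * d"
        using cinner.parallelogram[of "x - u" "x - v"] by linarith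
      also have "\<dots> \<le> 4 / real (Suc n)"
        using uv by (simp add: S_def)
      also have "\<dots> < e\<^sup>2"
        using n \<open>0 < e\<close> by (simp add: field_simps add_strict_increasing)
      finally have "(dist u v)\<^sup>2 < e\<^sup>2"
        by (simp add: dist_norm norm_minus_commute)
      then show ?thesis using \<open>0 < e\<close> by (simp add: power2_less_imp_less)
    qed
    then show ?thesis by blast
  qed
  ultimately obtain p where p: "\<And>n. p \<in> S n"
    using decreasing_closed_nest[of S] by metis
  have "(norm (x - p))\<^sup>2 \<le> d"
  proof (rule field_le_epsilon)
    fix e :: real assume "0 < e"
    then obtain n where "1 / real (Suc n) < e" using nat_approx_posE by blast
    then show "(norm (x - p))\<^sup>2 \<le> d + e" using p[of n] by (simp add: S_def)
  qed
  then have "norm (x - p) \<le> norm (x - m)" if "m \<in> M" for m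
    using d[OF that] by (auto intro: power2_le_imp_le[OF order_trans])
  then show thesis using p[of 0] that by (auto simp: S_def)
qed

text \<open>Take p closest to x. A nonzero component of \<open>x - p\<close> along some m in
  \<open>M\<close> could be moved into p, and by Pythagoras this would bring p strictly
  closer.\<close>

lemma orthogonal_decomposition:
  fixes M :: "'a::complex_hilbert set"
  assumes "closed M" "csubspace M"
  obtains p where "p \<in> M" "\<And>m. m \<in> M \<Longrightarrow> cinner (x - p) m = 0"
proof -
  obtain p where p: "p \<in> M" "\<And>m. m \<in> M \<Longrightarrow> norm (x - p) \<le> norm (x - m)"
    using closest_point_exists[OF assms] by blast
  have "cinner (x - p) m = 0" if m: "m \<in> M" for m
  proof (cases "m = 0")
    case False
    define c where "c = cinner (x - p) m / cinner m m"
    have mm: "cinner m m \<noteq> 0" using False cinner_self_eq_zero by blast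
    have 0: "cinner (x - p - c *\<^sub>C m) m = 0"
      using mm by (simp add: cinner.diff_left[of "x - p"] cinner.scaleC_left c_def)
    have "p + c *\<^sub>C m \<in> M" using p m csubspaceD[OF assms(2)] by blast
    from p(2)[OF this] have "(norm (x - p))\<^sup>2 \<le> (norm (x - p - c *\<^sub>C m))\<^sup>2"
      by (simp add: diff_diff_eq)
    moreover have "(norm (x - p))\<^sup>2 = (norm (x - p - c *\<^sub>C m))\<^sup>2 + (norm (c *\<^sub>C m))\<^sup>2"
      using cinner.sn_add_sq[of "x - p - c *\<^sub>C m" "c *\<^sub>C m"] by (simp add: cinner.scaleC_right 0)
    ultimately have "c *\<^sub>C m = 0" by simp
    then show ?thesis using 0 by simp
  qed simp
  then show thesis using p(1) that by blast
qed

section \<open>Riesz representation and the Hilbert space adjoint\<close>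

text \<open>The representing vector is a multiple of v, the part of some \<open>x0\<close> outside
  the kernel that is orthogonal to the kernel.\<close>

lemma Riesz_representation:
  fixes f :: "'a::complex_hilbert \<Rightarrow> complex"
  assumes f: "bounded_linear f" "\<And>c x. f (c *\<^sub>C x) = c * f x"
  obtains y where "\<And>x. f x = cinner x y"
proof (cases "\<forall>x. f x = 0")
  case True
  then show thesis using that[of 0] by simp
next
  case False
  interpret bounded_linear f by (fact f)
  define M where "M = {x. f x = 0}"
  have M: "closed M" "csubspace M"
    unfolding M_def csubspace_def
    by (auto simp: add f zero intro!: closed_Collect_eq continuous_on continuous_intros)
  obtain x0 where x0: "f x0 \<noteq> 0" using False by blast
  obtain p where p: "p \<in> M" "\<And>m. m \<in> M \<Longrightarrow> cinner (x0 - p) m = 0"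
    using orthogonal_decomposition[OF M] by blast
  define v where "v = x0 - p"
  have fv: "f v \<noteq> 0" using x0 p(1) by (simp add: v_def M_def diff)
  then have vv: "cinner v v \<noteq> 0" by (auto simp: cinner_self_eq_zero zero)
  have "f x = cinner x (cnj (f v / cinner v v) *\<^sub>C v)" for x
  proof -
    \<comment> \<open>Removing this multiple of v lands in the kernel, hence orthogonally to v;
      solving for \<open>f x\<close> gives the scalar, conjugated because \<open>cinner\<close> is
      conjugate-linear on the right.\<close>
    have "x - (f x / f v) *\<^sub>C v \<in> M" using fv by (simp add: M_def diff f)
    then have "cinner (x - (f x / f v) *\<^sub>C v) v = 0"
      using p(2) cinner_commute[of _ v] by (simp add: v_def)
    then show ?thesis
      using fv vv by (simp add: cinner.diff_left cinner.scaleC_left cinner.scaleC_right field_simps)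
  qed
  then show thesis using that by blast
qed

lemma cinner_right_ext: "(\<And>x. cinner x y = cinner x z) \<Longrightarrow> y = z"
  using cinner_self_eq_zero[of "y - z"] by (simp add: cinner.diff_right)

text \<open>Riesz gives \<open>S y\<close> for each y separately; linearity of S follows from
  uniqueness of the representing vector, and its bound from
  \<open>(norm (S y))\<^sup>2 = Re (cinner (T (S y)) y)\<close>.\<close>

lemma adjoint_exists:
  assumes "bounded_clinear T"
  obtains S where "bounded_clinear S" "\<And>x y. cinner (T x) y = cinner x (S y)"
proof -
  note T = bounded_clinearD[OF assms]
  have "\<exists>z. \<forall>x. cinner (T x) y = cinner x z" for y
  proof -
    have "bounded_linear (\<lambda>x. cinner (T x) y)"
      by (rule bounded_linear_compose[OF bounded_linear_cinner_left T(1)])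
    then obtain z where "\<And>x. cinner (T x) y = cinner x z"
      by (rule Riesz_representation) (simp_all add: T(6) cinner.scaleC_left)
    then show ?thesis by blast
  qed
  then obtain S where S: "cinner (T x) y = cinner x (S y)" for x y by metis
  obtain K where K: "0 \<le> K" "\<And>x. norm (T x) \<le> K * norm x"
    using bounded_clinear_bound[OF assms] by blast
  have "norm (S y) \<le> K * norm y" for y
  proof (cases "S y = 0")
    case False
    have "(norm (S y))\<^sup>2 = Re (cinner (T (S y)) y)" by (simp add: cinner.sn_sq S)
    also have "\<dots> \<le> norm (T (S y)) * norm y" by (rule cinner.Re_ip_le)
    also have "\<dots> \<le> (K * norm (S y)) * norm y" by (intro mult_right_mono K) auto
    finally have "norm (S y) * norm (S y) \<le> norm (S y) * (K * norm y)"
      by (simp add: power2_eq_square mult_ac)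
    then show ?thesis using False by simp
  qed (simp add: K)
  moreover have "S (x + y) = S x + S y" for x y
    by (rule cinner_right_ext) (simp add: cinner.add_right flip: S)
  moreover have "S (c *\<^sub>C x) = c *\<^sub>C S x" for c x
    by (rule cinner_right_ext) (simp add: cinner.scaleC_right flip: S)
  ultimately have "bounded_clinear S" by (intro bounded_clinearI)
  then show thesis using S that by blast
qed

lemma cadjoint:
  assumes "bounded_clinear T"
  shows "bounded_clinear (cadjoint T)" "cinner (T x) y = cinner x (cadjoint T y)"
proof -
  obtain S where S: "bounded_clinear S" "\<And>x y. cinner (T x) y = cinner x (S y)"
    using adjoint_exists[OF assms] by blast
  have "cadjoint T = S"
    unfolding cadjoint_def
  proof (rule the_equality)
    show "bounded_clinear S \<and> (\<forall>x y. cinner (T x) y = cinner x (S y))"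
      using S by blast
  next
    fix S' assume S': "bounded_clinear S' \<and> (\<forall>x y. cinner (T x) y = cinner x (S' y))"
    have "S' y = S y" for y
      by (rule cinner_right_ext) (use S(2) S' in metis)
    then show "S' = S" by blast
  qed
  with S show "bounded_clinear (cadjoint T)" "cinner (T x) y = cinner x (cadjoint T y)"
    by auto
qed

section \<open>The semi-inner product of a positive operator\<close>

locale positive_operator =
  fixes A :: "'a::complex_hilbert \<Rightarrow> 'a"
  assumes positive: "positive_op A"
begin

lemma bounded_clinear_A: "bounded_clinear A"
  using positive by (simp add: positive_op_def)

lemmas A_simps = bounded_clinearD(2-7)[OF bounded_clinear_A]

text \<open>Polarization: \<open>cinner (A z) z\<close> is real for \<open>z = x + y\<close> and for \<open>z = x + \<i> y\<close>.\<close>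

lemma A_hermitian: "cinner (A x) y = cinner x (A y)"
proof -
  have Im0: "Im (cinner (A z) z) = 0" for z
    using positive by (auto simp: positive_op_def complex_nonneg_Reals_iff)
  have "Im (cinner (A x) y) = - Im (cinner (A y) x)"
    using Im0[of "x + y"] Im0[of x] Im0[of y]
    by (simp add: A_simps cinner.add_left cinner.add_right)
  moreover have "Re (cinner (A x) y) = Re (cinner (A y) x)"
    using Im0[of "x + \<i> *\<^sub>C y"] Im0[of x] Im0[of y]
    by (simp add: A_simps cinner.add_left cinner.add_right cinner.scaleC_left cinner.scaleC_right)
  ultimately show ?thesis
    using cinner_commute[of x "A y"] by (simp add: complex_eq_iff)
qed

sublocale A: semi_inner "A_inner A"
  rewrites "semi_inner.sn (A_inner A) = A_seminorm A"
proof -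
  show *: "semi_inner (A_inner A)"
  proof
    show "A_inner A x y = cnj (A_inner A y x)" for x y
      unfolding A_inner_def using A_hermitian cinner_commute by metis
    show "A_inner A x x \<in> \<real>\<^sub>\<ge>\<^sub>0" for x
      using positive by (simp add: A_inner_def positive_op_def)
  qed (simp_all add: A_inner_def A_simps cinner.add_left cinner.scaleC_left)
  show "semi_inner.sn (A_inner A) = A_seminorm A"
    by (rule ext) (simp add: semi_inner.sn_def[OF *] A_seminorm_def)
qed

lemma A_inner_right: "A_inner A x y = cinner x (A y)"
  by (simp add: A_inner_def A_hermitian)

lemma kernel_orthogonal_range:
  assumes "A k = 0" "z \<in> closure (range A)"
  shows "cinner k z = 0"
proof -
  have "closed {z. cinner k z = 0}"
    by (intro closed_Collect_eq linear_continuous_on bounded_linear_cinner_right continuous_on_const)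
  moreover have "range A \<subseteq> {z. cinner k z = 0}"
    using assms(1) by (auto simp flip: A_hermitian)
  ultimately show ?thesis
    using closure_minimal assms(2) by blast
qed

lemma csubspace_closure_range: "csubspace (closure (range A))"
  by (intro csubspace_closure csubspace_range bounded_clinear_A)

text \<open>The difference lies both in the kernel of A and in the closed range, which are
  orthogonal. This yields uniqueness of \<open>A_sharp A T\<close>.\<close>

lemma A_inj_on_closure_range:
  assumes "x \<in> closure (range A)" "y \<in> closure (range A)" "A x = A y"
  shows "x = y"
proof -
  have "cinner (x - y) (x - y) = 0"
    using assms csubspaceD(5)[OF csubspace_closure_range]
    by (intro kernel_orthogonal_range) (auto simp: A_simps)
  then show ?thesis by (simp add: cinner_self_eq_zero)
qed

text \<open>Projecting x onto the closed range changes it only by an element of the kernel of A, so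
  values of the A-form can be computed there.\<close>

lemma closure_range_representative:
  obtains p where "p \<in> closure (range A)" "A p = A x"
proof -
  obtain p where p: "p \<in> closure (range A)" "\<And>m. m \<in> closure (range A) \<Longrightarrow> cinner (x - p) m = 0"
    using orthogonal_decomposition[OF closed_closure csubspace_closure_range] by blast
  \<comment> \<open>Moving one A across turns this into the product of \<open>x - p\<close> with an
    element of the range.\<close>
  have "cinner (A (x - p)) (A (x - p)) = 0"
    using p(2)[of "A (A (x - p))"] closure_subset[of "range A"] by (auto simp: A_hermitian)
  then have "A p = A x" by (simp add: cinner_self_eq_zero A_simps)
  then show thesis using p(1) that by blast
qed

lemma A_seminorm_le_norm:
  obtains K where "0 \<le> K" "\<And>x. A_seminorm A x \<le> K * norm x"
proof -
  obtain M where M: "0 \<le> M" "\<And>x. norm (A x) \<le> M * norm x"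
    using bounded_clinear_bound[OF bounded_clinear_A] by blast
  have "A_seminorm A x \<le> sqrt M * norm x" for x
  proof (rule power2_le_imp_le)
    have "(A_seminorm A x)\<^sup>2 \<le> norm (A x) * norm x"
      using cinner.Re_ip_le[of "A x" x] by (simp add: A.sn_sq A_inner_def)
    also have "\<dots> \<le> M * norm x * norm x" by (intro mult_right_mono M) auto
    finally show "(A_seminorm A x)\<^sup>2 \<le> (sqrt M * norm x)\<^sup>2"
      using M(1) by (simp add: power_mult_distrib power2_eq_square[of "norm x"])
  qed (use M in simp)
  then show thesis using M(1) that[of "sqrt M"] by simp
qed

section \<open>Adjoints for the A-form and existence of the sharp operator\<close>

text \<open>A symmetric relation without a range condition: T is always an A-adjoint of
  \<open>A_sharp A T\<close>, yet it can differ from the sharp of that operator because its range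
  may leave the closure of \<open>range A\<close>.\<close>

definition A_adjoint_pair :: "('a \<Rightarrow> 'a) \<Rightarrow> ('a \<Rightarrow> 'a) \<Rightarrow> bool" where
  "A_adjoint_pair T S \<longleftrightarrow> bounded_clinear T \<and> bounded_clinear S \<and>
     (\<forall>x y. A_inner A (T x) y = A_inner A x (S y))"

lemma A_adjoint_pair_sym: "A_adjoint_pair T S \<Longrightarrow> A_adjoint_pair S T"
  unfolding A_adjoint_pair_def using A.commute by metis

lemma A_sharp_eqI:
  assumes "A_adjoint_pair T S" "range S \<subseteq> closure (range A)"
  shows "A_sharp A T = S"
proof -
  have T: "bounded_clinear T" and S: "bounded_clinear S"
    and TS: "A_inner A (T x) y = A_inner A x (S y)" for x y
    using assms(1) by (auto simp: A_adjoint_pair_def)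
  have AS: "A (S y) = cadjoint T (A y)" for y
    by (rule cinner_right_ext)
      (use TS in \<open>simp add: A_inner_right flip: cadjoint(2)[OF T]\<close>)
  show ?thesis
    unfolding A_sharp_def
  proof (rule the_equality)
    show "bounded_clinear S \<and> A \<circ> S = cadjoint T \<circ> A \<and> range S \<subseteq> closure (range A)"
      using S AS assms(2) by auto
  next
    fix X assume X: "bounded_clinear X \<and> A \<circ> X = cadjoint T \<circ> A \<and> range X \<subseteq> closure (range A)"
    have "X y = S y" for y
    proof (rule A_inj_on_closure_range)
      show "X y \<in> closure (range A)" "S y \<in> closure (range A)" using X assms(2) by auto
      show "A (X y) = A (S y)" using X AS by (metis comp_apply)
    qed
    then show "X = S" by blast
  qed
qed

text \<open>Boundedness in Douglas' lemma. Since \<open>cinner (X x) (A u) = cinner x (A (T u))\<close>, the sets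
  \<open>{x. norm (X x) \<le> n}\<close> are closed; they cover the space, so Baire's theorem applies.\<close>

lemma A_adjoint_exists:
  assumes "T \<in> A_adjointable A"
  obtains S where "A_adjoint_pair T S" "range S \<subseteq> closure (range A)"
proof -
  have T: "bounded_clinear T" and ran: "range (cadjoint T \<circ> A) \<subseteq> range A"
    using assms by (auto simp: A_adjointable_def)
  have "\<exists>z\<in>closure (range A). A z = cadjoint T (A y)" for y
  proof -
    obtain x where "A x = cadjoint T (A y)" using ran by (metis comp_apply imageE rangeI subsetD)
    then show ?thesis using closure_range_representative[of x] by metis
  qed
  then obtain X where X: "\<And>y. X y \<in> closure (range A)" "\<And>y. A (X y) = cadjoint T (A y)"
    by metis
  note cT = bounded_clinearD[OF cadjoint(1)[OF T]]
  have add: "X (x + y) = X x + X y" for x y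
    using X csubspaceD(2)[OF csubspace_closure_range]
    by (intro A_inj_on_closure_range[of "X (x + y)"]) (auto simp: A_simps cT)
  have scale: "X (c *\<^sub>C x) = c *\<^sub>C X x" for c x
    using X csubspaceD(3)[OF csubspace_closure_range]
    by (intro A_inj_on_closure_range[of "X (c *\<^sub>C x)"]) (auto simp: A_simps cT)
  have adj: "A_inner A (T x) y = A_inner A x (X y)" for x y
    by (simp add: A_inner_right X cadjoint(2)[OF T])
  have swap: "cinner (X x) (A u) = cinner x (A (T u))" for x u
    using adj[of u x] A.commute[of "X x" u] A.commute[of x "T u"] by (simp add: A_inner_right)
  define F where "F n = {x. \<forall>u. cmod (cinner x (A (T u))) \<le> real n * norm (A u)}" for n
  have F: "x \<in> F n \<longleftrightarrow> norm (X x) \<le> real n" for x n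
  proof
    assume "norm (X x) \<le> real n"
    then have "cmod (cinner (X x) (A u)) \<le> real n * norm (A u)" for u
      using order_trans[OF cinner.Cauchy_Schwarz mult_right_mono] by fastforce
    then show "x \<in> F n" by (simp add: F_def swap)
  next
    assume x: "x \<in> F n"
    \<comment> \<open>The bound known on \<open>range A\<close> passes to its closure, which
      contains \<open>X x\<close>; so z may be taken to be \<open>X x\<close> itself.\<close>
    have "closed {z. cmod (cinner (X x) z) \<le> real n * norm z}"
      by (intro closed_Collect_le continuous_intros linear_continuous_on bounded_linear_cinner_right)
    moreover have "range A \<subseteq> {z. cmod (cinner (X x) z) \<le> real n * norm z}"
      using x by (auto simp: F_def swap)
    ultimately have "cmod (cinner (X x) (X x)) \<le> real n * norm (X x)"
      using closure_minimal X(1) by blast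
    then have "norm (X x) * norm (X x) \<le> real n * norm (X x)"
      by (simp add: cinner.ip_self norm_power power2_eq_square[of "norm (X x)"] norm_mult)
    then show "norm (X x) \<le> real n"
      by (cases "X x = 0") simp_all
  qed
  have closed: "closed (F n)" for n
    unfolding F_def
    by (intro closed_Collect_all closed_Collect_le continuous_intros linear_continuous_on
        bounded_linear_cinner_left)
  have "\<exists>n. interior (F n) \<noteq> {}"
  proof (rule ccontr)
    assume "\<not> (\<exists>n. interior (F n) \<noteq> {})"
    then have "euclidean interior_of \<Union>(range F) = {}"
      using closed by (intro Baire_category_alt) (auto simp: completely_metrizable_space_euclidean)
    moreover have "\<Union>(range F) = UNIV"
      using F real_arch_simple by auto
    ultimately show False by simp
  qed
  then obtain n x0 r where r: "0 < r" "ball x0 r \<subseteq> F n"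
    using mem_interior by blast
  have small: "norm (X x) \<le> 2 * real n" if "norm x < r" for x
  proof -
    \<comment> \<open>\<open>X x\<close> is the difference of the values at these two points, each
      of norm at most n.\<close>
    have "x0 + x \<in> F n" "x0 \<in> F n" using r that by (auto simp: subset_iff dist_norm)
    then show ?thesis
      using norm_triangle_ineq4[of "X (x0 + x)" "X x0"] by (simp add: F add)
  qed
  have "norm (X x) \<le> (4 * real n / r) * norm x" for x
  proof (cases "x = 0")
    case True
    then show ?thesis using add[of 0 0] by simp
  next
    case False
    have "norm ((r / (2 * norm x)) *\<^sub>R x) < r" using r False by simp
    from small[OF this] have "r / (2 * norm x) * norm (X x) \<le> 2 * real n"
      using r(1) by (simp add: scaleR_scaleC scale cinner.sn_scaleC norm_divide norm_mult)
    then show ?thesis using r(1) False by (simp add: field_simps)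
  qed
  then have "bounded_clinear X" using add scale by (intro bounded_clinearI)
  then show thesis using that[of X] T adj X(1) by (auto simp: A_adjoint_pair_def)
qed

lemma A_sharp:
  assumes "T \<in> A_adjointable A"
  shows "A_adjoint_pair T (A_sharp A T)" "range (A_sharp A T) \<subseteq> closure (range A)"
  using A_adjoint_exists[OF assms] A_sharp_eqI by metis+

section \<open>Boundedness in the A-seminorm and the two suprema\<close>

definition A_bounded :: "('a \<Rightarrow> 'a) \<Rightarrow> bool" where
  "A_bounded T \<longleftrightarrow> (\<exists>K. \<forall>x. A_seminorm A (T x) \<le> K * A_seminorm A x)"

text \<open>The composite of T followed by S is symmetric for the A-form, so its norm bound M also
  bounds it in the seminorm; then \<open>(A_seminorm A (T x))\<^sup>2\<close>, the A-product of x
  with \<open>S (T x)\<close>, is at most M times the square for x.\<close>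

lemma A_adjoint_pair_bounded:
  assumes "A_adjoint_pair T S"
  shows "A_bounded T"
proof -
  have T: "bounded_clinear T" and S: "bounded_clinear S"
    and TS: "A_inner A (T x) y = A_inner A x (S y)"
    and ST: "A_inner A (S x) y = A_inner A x (T y)" for x y
    using assms A_adjoint_pair_sym[OF assms] by (auto simp: A_adjoint_pair_def)
  have B: "bounded_clinear (\<lambda>x. S (T x))" by (rule bounded_clinear_comp[OF S T])
  obtain K where K: "0 \<le> K" "\<And>x. A_seminorm A x \<le> K * norm x"
    using A_seminorm_le_norm by blast
  obtain M where M: "0 \<le> M" "\<And>x. norm (S (T x)) \<le> M * norm x"
    using bounded_clinear_bound[OF B] by blast
  have B_le: "A_seminorm A (S (T x)) \<le> M * A_seminorm A x" for x
    by (rule A.sn_symmetric_bounded[OF _ _ K(2) M(2,1) K(1)])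
      (simp_all add: bounded_clinearD(7)[OF B] ST TS)
  have "A_seminorm A (T x) \<le> sqrt M * A_seminorm A x" for x
  proof (rule power2_le_imp_le)
    have "(A_seminorm A (T x))\<^sup>2 \<le> A_seminorm A x * A_seminorm A (S (T x))"
      using A.Re_ip_le[of x "S (T x)"] by (simp add: A.sn_sq TS)
    also have "\<dots> \<le> A_seminorm A x * (M * A_seminorm A x)"
      by (intro mult_left_mono B_le) simp
    finally show "(A_seminorm A (T x))\<^sup>2 \<le> (sqrt M * A_seminorm A x)\<^sup>2"
      using M(1) by (simp add: power_mult_distrib power2_eq_square[of "A_seminorm A x"] mult_ac)
  qed (use M in simp)
  then show ?thesis by (auto simp: A_bounded_def)
qed

lemma A_norm_le:
  assumes "0 \<le> c" "\<And>x. A_seminorm A x = 1 \<Longrightarrow> A_seminorm A (T x) \<le> c"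
  shows "A_norm A T \<le> c"
  unfolding A_norm_def by (rule cSup_least) (use assms in auto)

lemma A_norm_upper:
  assumes "A_bounded T"
  shows "0 \<le> A_norm A T"
    and "x \<in> closure (range A) \<Longrightarrow> A_seminorm A x = 1 \<Longrightarrow> A_seminorm A (T x) \<le> A_norm A T"
proof -
  obtain K where "\<And>x. A_seminorm A (T x) \<le> K * A_seminorm A x"
    using assms by (auto simp: A_bounded_def)
  then have K: "A_seminorm A (T x) \<le> \<bar>K\<bar>" if "A_seminorm A x = 1" for x
    using that by (metis abs_ge_self mult.right_neutral order_trans)
  have bdd: "bdd_above
      (insert 0 {A_seminorm A (T x) | x. x \<in> closure (range A) \<and> A_seminorm A x = 1})"
    by (rule bdd_aboveI[of _ "\<bar>K\<bar>"]) (use K in auto)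
  show "0 \<le> A_norm A T"
    unfolding A_norm_def by (rule cSup_upper[OF _ bdd]) simp
  show "x \<in> closure (range A) \<Longrightarrow> A_seminorm A x = 1 \<Longrightarrow> A_seminorm A (T x) \<le> A_norm A T"
    unfolding A_norm_def by (rule cSup_upper[OF _ bdd]) auto
qed

text \<open>Passes from the closed range, where the supremum is taken, to all vectors: x and its
  representative p differ by a null vector, and A-boundedness makes T send null vectors to null
  vectors.\<close>

lemma A_seminorm_le_A_norm:
  assumes "bounded_clinear T" "A_bounded T"
  shows "A_seminorm A (T x) \<le> A_norm A T * A_seminorm A x"
proof -
  obtain K where K: "\<And>x. A_seminorm A (T x) \<le> K * A_seminorm A x"
    using assms(2) by (auto simp: A_bounded_def)
  obtain p where p: "p \<in> closure (range A)" "A p = A x"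
    using closure_range_representative by blast
  have null: "A_seminorm A (x - p) = 0"
    using p(2) by (simp add: A_seminorm_def A_inner_def A_simps)
  then have null': "A_seminorm A (T x - T p) = 0"
    using K[of "x - p"] A.sn_nonneg[of "T x - T p"] by (simp add: bounded_clinearD[OF assms(1)])
  have le: "A_seminorm A (T x) \<le> A_seminorm A (T p)"
    using A.triangle[of "T x - T p" "T p"] null' by simp
  have eq: "A_seminorm A x = A_seminorm A p"
    using A.triangle[of "x - p" p] A.triangle[of "- (x - p)" x] null A.sn_minus[of "x - p"] by simp
  have "A_seminorm A (T p) \<le> A_norm A T * A_seminorm A p"
  proof (cases "A_seminorm A p = 0")
    case True
    then show ?thesis using K[of p] by simp
  next
    case False
    then have pos: "0 < A_seminorm A p" by (simp add: less_le)
    define q where "q = (1 / A_seminorm A p) *\<^sub>R p"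
    have "q \<in> closure (range A)" "A_seminorm A q = 1"
      using p(1) pos csubspaceD(4)[OF csubspace_closure_range] by (auto simp: q_def A.sn_scaleR)
    from A_norm_upper(2)[OF assms(2) this] show ?thesis
      using pos by (simp add: q_def bounded_clinearD[OF assms(1)] A.sn_scaleR field_simps)
  qed
  then show ?thesis using le eq by simp
qed

lemma A_numerical_radius_le:
  assumes "0 \<le> c" "\<And>x. A_seminorm A x = 1 \<Longrightarrow> cmod (A_inner A (T x) x) \<le> c"
  shows "A_numerical_radius A T \<le> c"
  unfolding A_numerical_radius_def by (rule cSup_least) (use assms in auto)

lemma A_numerical_radius_upper:
  assumes T: "bounded_clinear T" and "A_bounded T"
  shows "0 \<le> A_numerical_radius A T"
    and "cmod (A_inner A (T x) x) \<le> A_numerical_radius A T * (A_seminorm A x)\<^sup>2"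
proof -
  obtain K where K: "\<And>x. A_seminorm A (T x) \<le> K * A_seminorm A x"
    using assms(2) by (auto simp: A_bounded_def)
  have "cmod (A_inner A (T x) x) \<le> \<bar>K\<bar>" if "A_seminorm A x = 1" for x
    using A.Cauchy_Schwarz[of "T x" x] K[of x] that by simp
  then have bdd: "bdd_above (insert 0 {cmod (A_inner A (T x) x) | x. A_seminorm A x = 1})"
    by (intro bdd_aboveI[of _ "\<bar>K\<bar>"]) auto
  then show "0 \<le> A_numerical_radius A T"
    unfolding A_numerical_radius_def by (intro cSup_upper) auto
  show "cmod (A_inner A (T x) x) \<le> A_numerical_radius A T * (A_seminorm A x)\<^sup>2"
  proof (cases "A_seminorm A x = 0")
    case True
    then show ?thesis using A.Cauchy_Schwarz[of "T x" x] by simp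
  next
    case False
    then have pos: "0 < A_seminorm A x" by (simp add: less_le)
    define q where "q = (1 / A_seminorm A x) *\<^sub>R x"
    have "A_seminorm A q = 1" using pos by (simp add: q_def A.sn_scaleR)
    then have "cmod (A_inner A (T q) q) \<le> A_numerical_radius A T"
      unfolding A_numerical_radius_def by (intro cSup_upper[OF _ bdd]) auto
    then show ?thesis
      using pos by (simp add: q_def bounded_clinearD[OF T] A.scaleR_left A.scaleR_right
          norm_mult norm_divide field_simps power2_eq_square)
  qed
qed

lemma A_adjoint_pair_scaleC:
  assumes "A_adjoint_pair T S"
  shows "A_adjoint_pair (\<lambda>x. c *\<^sub>C T x) (\<lambda>x. cnj c *\<^sub>C S x)"
  using assms
  by (auto simp: A_adjoint_pair_def A.scaleC_left A.scaleC_right intro: bounded_clinear_scaleC)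

lemma A_adjoint_pair_add:
  assumes "A_adjoint_pair T S" "A_adjoint_pair T' S'"
  shows "A_adjoint_pair (\<lambda>x. T x + T' x) (\<lambda>x. S x + S' x)"
  using assms
  by (auto simp: A_adjoint_pair_def A.add_left A.add_right intro: bounded_clinear_add)

lemma A_adjoint_pair_comp:
  assumes "A_adjoint_pair T S" "A_adjoint_pair T' S'"
  shows "A_adjoint_pair (\<lambda>x. T (T' x)) (\<lambda>x. S' (S x))"
  using assms by (auto simp: A_adjoint_pair_def intro: bounded_clinear_comp)

section \<open>Rotated real parts and the equivalence\<close>

context
  fixes T :: "'a \<Rightarrow> 'a"
  assumes T: "T \<in> A_adjointable A"
begin

lemmas A_sharp_pair = A_sharp(1)[OF T]

lemma A_sharp_scaleC: "A_sharp A (\<lambda>x. c *\<^sub>C T x) = (\<lambda>x. cnj c *\<^sub>C A_sharp A T x)"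
  using A_sharp[OF T] csubspaceD(3)[OF csubspace_closure_range]
  by (intro A_sharp_eqI A_adjoint_pair_scaleC) auto

definition Re_rot :: "complex \<Rightarrow> 'a \<Rightarrow> 'a" where
  "Re_rot u x = (1 / 2) *\<^sub>C (u *\<^sub>C T x + cnj u *\<^sub>C A_sharp A T x)"

lemma A_Re_scaleC: "A_Re A (\<lambda>x. u *\<^sub>C T x) = Re_rot u"
  by (rule ext) (simp add: A_Re_def Re_rot_def A_sharp_scaleC)

lemma A_Im_scaleC: "A_Im A (\<lambda>x. u *\<^sub>C T x) = Re_rot (- \<i> * u)"
proof
  fix x
  have "1 / (2 * \<i>) * u = 1 / 2 * (- \<i> * u)" "- (1 / (2 * \<i>) * cnj u) = 1 / 2 * cnj (- \<i> * u)"
    by (simp_all add: field_simps)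
  then show "A_Im A (\<lambda>x. u *\<^sub>C T x) x = Re_rot (- \<i> * u) x"
    unfolding A_Im_def Re_rot_def A_sharp_scaleC scaleC_diff_right scaleC_add_right scaleC_scaleC
    by (simp only: scaleC_minus_left[symmetric] diff_conv_add_uminus)
qed

text \<open>Taking A-adjoints swaps the two summands. This is symmetry for the A-form only;
  \<open>Re_rot u\<close> may differ from its own sharp.\<close>

lemma Re_rot_self_adjoint: "A_adjoint_pair (Re_rot u) (Re_rot u)"
proof -
  have "A_adjoint_pair (\<lambda>x. u *\<^sub>C T x + cnj u *\<^sub>C A_sharp A T x)
      (\<lambda>x. cnj u *\<^sub>C A_sharp A T x + cnj (cnj u) *\<^sub>C T x)"
    by (intro A_adjoint_pair_add A_adjoint_pair_scaleC A_sharp_pair A_adjoint_pair_sym[OF A_sharp_pair])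
  from A_adjoint_pair_scaleC[OF this, of "1 / 2"] show ?thesis
    by (simp add: Re_rot_def[abs_def] add.commute)
qed

lemma bounded_clinear_Re_rot: "bounded_clinear (Re_rot u)"
  using Re_rot_self_adjoint[of u] by (simp add: A_adjoint_pair_def)

lemma A_bounded_Re_rot: "A_bounded (Re_rot u)"
  by (rule A_adjoint_pair_bounded[OF Re_rot_self_adjoint])

lemma A_seminorm_Re_rot_le: "A_seminorm A (Re_rot u x) \<le> A_norm A (Re_rot u) * A_seminorm A x"
  by (rule A_seminorm_le_A_norm[OF bounded_clinear_Re_rot A_bounded_Re_rot])

lemma A_norm_Re_rot_nonneg: "0 \<le> A_norm A (Re_rot u)"
  by (rule A_norm_upper(1)[OF A_bounded_Re_rot])

lemma A_inner_Re_rot: "A_inner A (Re_rot u x) x = of_real (Re (u * A_inner A (T x) x))"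
proof -
  have "A_inner A (A_sharp A T x) x = cnj (A_inner A (T x) x)"
    using A_sharp_pair A.commute by (metis A_adjoint_pair_def)
  then have "A_inner A (Re_rot u x) x = 1 / 2 * (u * A_inner A (T x) x + cnj (u * A_inner A (T x) x))"
    by (simp add: Re_rot_def A.scaleC_left A.add_left)
  also have "\<dots> = of_real (Re (u * A_inner A (T x) x))"
    unfolding complex_add_cnj by (simp only: of_real_mult of_real_numeral) simp
  finally show ?thesis .
qed

lemma bounded_T: "bounded_clinear T" "A_bounded T"
  using A_sharp_pair A_adjoint_pair_bounded by (auto simp: A_adjoint_pair_def)

text \<open>The quadratic form of \<open>Re_rot u\<close> is the real part of a rotated value of the
  form of T, and \<open>A.sn_symmetric_le\<close> turns the bound on it into a seminorm
  bound.\<close>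

lemma A_norm_Re_rot_le_A_numerical_radius:
  assumes "cmod u = 1"
  shows "A_norm A (Re_rot u) \<le> A_numerical_radius A T"
proof (rule A_norm_le[OF A_numerical_radius_upper(1)[OF bounded_T]])
  have "cmod (A_inner A (Re_rot u x) x) \<le> A_numerical_radius A T * (A_seminorm A x)\<^sup>2" for x
  proof -
    have "cmod (A_inner A (Re_rot u x) x) \<le> cmod (u * A_inner A (T x) x)"
      unfolding A_inner_Re_rot norm_of_real by (rule abs_Re_le_cmod)
    then show ?thesis
      using A_numerical_radius_upper(2)[OF bounded_T, of x] assms by (simp add: norm_mult)
  qed
  then have "A_seminorm A (Re_rot u x) \<le> A_numerical_radius A T * A_seminorm A x" for x
    using Re_rot_self_adjoint[of u]
    by (intro A.sn_symmetric_le[of "Re_rot u"])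
      (auto simp: bounded_clinearD(2)[OF bounded_clinear_Re_rot] A_adjoint_pair_def)
  then show "A_seminorm A x = 1 \<Longrightarrow> A_seminorm A (Re_rot u x) \<le> A_numerical_radius A T" for x
    by (metis mult.right_neutral)
qed

lemma A_numerical_radius_le_A_norm_Re_rot:
  assumes "\<And>\<theta>. A_norm A (Re_rot (exp (\<i> * of_real \<theta>))) \<le> c"
  shows "A_numerical_radius A T \<le> c"
proof (rule A_numerical_radius_le)
  show "0 \<le> c" using A_norm_Re_rot_nonneg assms order_trans by blast
  fix x assume x: "A_seminorm A x = 1"
  \<comment> \<open>The angle depends on x: it rotates the value of the form at x onto the
    nonnegative reals, where taking the real part loses nothing.\<close>
  define \<theta> where "\<theta> = - Arg (A_inner A (T x) x)"
  define u where "u = exp (\<i> * of_real \<theta>)"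
  have "A_inner A (T x) x = of_real (cmod (A_inner A (T x) x)) * cnj u"
    using rcis_cmod_Arg[of "A_inner A (T x) x"]
    by (simp add: u_def \<theta>_def rcis_def cis_conv_exp exp_cnj)
  moreover have "u * cnj u = 1"
    by (simp add: u_def exp_cnj flip: exp_add)
  ultimately have "u * A_inner A (T x) x = of_real (cmod (A_inner A (T x) x))"
    by (metis mult.left_commute mult.right_neutral)
  then have "cmod (A_inner A (T x) x) = cmod (A_inner A (Re_rot u x) x)"
    by (simp add: A_inner_Re_rot)
  also have "\<dots> \<le> A_norm A (Re_rot u)"
    using A.Cauchy_Schwarz[of "Re_rot u x" x] A_seminorm_Re_rot_le[of u x] x by simp
  also have "\<dots> \<le> c" unfolding u_def by (rule assms)
  finally show "cmod (A_inner A (T x) x) \<le> c" .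
qed

text \<open>Replacing u by \<open>- \<i> * u\<close> flips the coefficients of the squares of T and
  of its sharp but keeps those of the mixed products, each 1/4 since u is unimodular.\<close>

lemma Re_rot_squares:
  assumes "cmod u = 1"
  shows "A_sharp A T (T x) + T (A_sharp A T x) =
    2 *\<^sub>R (Re_rot u (Re_rot u x) + Re_rot (- \<i> * u) (Re_rot (- \<i> * u) x))"
proof -
  note T' = bounded_clinearD[OF bounded_T(1)]
  have "bounded_clinear (A_sharp A T)" using A_sharp_pair by (simp add: A_adjoint_pair_def)
  note S' = bounded_clinearD[OF this]
  define a b c d where "a = T (T x)" and "b = T (A_sharp A T x)" and "c = A_sharp A T (T x)"
    and "d = A_sharp A T (A_sharp A T x)"
  have expand: "Re_rot v (Re_rot v x) =
      (v * v / 4) *\<^sub>C a + (v * cnj v / 4) *\<^sub>C b + (v * cnj v / 4) *\<^sub>C c + (cnj v * cnj v / 4) *\<^sub>C d"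
    for v
    by (simp add: Re_rot_def T' S' scaleC_add_right scaleC_scaleC a_def b_def c_def d_def
        mult.commute add.assoc)
  have u: "u * cnj u = 1"
    using assms by (simp add: complex_norm_square[symmetric])
  have v: "(- \<i> * u) * (- \<i> * u) = - (u * u)" "(- \<i> * u) * cnj (- \<i> * u) = u * cnj u"
    "cnj (- \<i> * u) * cnj (- \<i> * u) = - (cnj u * cnj u)"
    by (simp_all add: algebra_simps)
  have "Re_rot u (Re_rot u x) + Re_rot (- \<i> * u) (Re_rot (- \<i> * u) x) =
      (1 / 4 + 1 / 4) *\<^sub>C b + (1 / 4 + 1 / 4) *\<^sub>C c"
    unfolding expand v u scaleC_add_left by (simp add: scaleC_minus_left)
  then show ?thesis
    by (simp add: scaleR_scaleC scaleC_add_right scaleC_scaleC scaleC_one b_def c_def add.commute)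
qed

lemma A_norm_sharp_squares_le:
  assumes "cmod u = 1"
  shows "A_norm A (\<lambda>x. A_sharp A T (T x) + T (A_sharp A T x)) \<le>
    2 * ((A_norm A (Re_rot u))\<^sup>2 + (A_norm A (Re_rot (- \<i> * u)))\<^sup>2)"
proof (rule A_norm_le)
  fix x assume x: "A_seminorm A x = 1"
  have sq: "A_seminorm A (Re_rot v (Re_rot v x)) \<le> (A_norm A (Re_rot v))\<^sup>2" for v
    using order_trans[OF A_seminorm_Re_rot_le[of v "Re_rot v x"]
        mult_left_mono[OF A_seminorm_Re_rot_le[of v x] A_norm_Re_rot_nonneg[of v]]]
    by (simp add: x power2_eq_square)
  have "A_seminorm A (A_sharp A T (T x) + T (A_sharp A T x)) =
      2 * A_seminorm A (Re_rot u (Re_rot u x) + Re_rot (- \<i> * u) (Re_rot (- \<i> * u) x))"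
    unfolding Re_rot_squares[OF assms] by (simp add: A.sn_scaleR)
  also have "\<dots> \<le> 2 * (A_seminorm A (Re_rot u (Re_rot u x)) +
      A_seminorm A (Re_rot (- \<i> * u) (Re_rot (- \<i> * u) x)))"
    by (intro mult_left_mono A.triangle) simp
  also have "\<dots> \<le> 2 * ((A_norm A (Re_rot u))\<^sup>2 + (A_norm A (Re_rot (- \<i> * u)))\<^sup>2)"
    by (intro mult_left_mono add_mono sq) simp
  finally show "A_seminorm A (A_sharp A T (T x) + T (A_sharp A T x)) \<le>
    2 * ((A_norm A (Re_rot u))\<^sup>2 + (A_norm A (Re_rot (- \<i> * u)))\<^sup>2)" .
qed simp

lemma A_norm_sharp_squares_nonneg: "0 \<le> A_norm A (\<lambda>x. A_sharp A T (T x) + T (A_sharp A T x))"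
  using A_adjoint_pair_add[OF A_adjoint_pair_comp[OF A_adjoint_pair_sym[OF A_sharp_pair] A_sharp_pair]
      A_adjoint_pair_comp[OF A_sharp_pair A_adjoint_pair_sym[OF A_sharp_pair]]]
  by (rule A_norm_upper(1)[OF A_adjoint_pair_bounded])

lemma A_numerical_radius_eq_iff:
  "A_numerical_radius A T = sqrt (1 / 4 * A_norm A (\<lambda>x. A_sharp A T (T x) + T (A_sharp A T x))) \<longleftrightarrow>
    (\<forall>\<theta>::real.
      (A_norm A (A_Re A (\<lambda>x. exp (\<i> * of_real \<theta>) *\<^sub>C T x)))\<^sup>2 =
        (A_norm A (A_Im A (\<lambda>x. exp (\<i> * of_real \<theta>) *\<^sub>C T x)))\<^sup>2 \<and>
      (A_norm A (A_Im A (\<lambda>x. exp (\<i> * of_real \<theta>) *\<^sub>C T x)))\<^sup>2 =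
        1 / 4 * A_norm A (\<lambda>x. A_sharp A T (T x) + T (A_sharp A T x)))"
    (is "?w = sqrt (1 / 4 * ?Q) \<longleftrightarrow> ?R")
proof
  assume w: "?w = sqrt (1 / 4 * ?Q)"
  show ?R
    unfolding A_Re_scaleC A_Im_scaleC
  proof
    fix \<theta> :: real
    let ?u = "exp (\<i> * of_real \<theta>)"
    have le: "(A_norm A (Re_rot v))\<^sup>2 \<le> 1 / 4 * ?Q" if "cmod v = 1" for v
      using power_mono[OF A_norm_Re_rot_le_A_numerical_radius[OF that] A_norm_Re_rot_nonneg, of 2]
        A_norm_sharp_squares_nonneg by (simp add: w)
    have "?Q \<le> 2 * ((A_norm A (Re_rot ?u))\<^sup>2 + (A_norm A (Re_rot (- \<i> * ?u)))\<^sup>2)"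
      by (rule A_norm_sharp_squares_le) simp
    \<comment> \<open>Two numbers, each at most \<open>1 / 4 * ?Q\<close>, have sum at least
      \<open>1 / 2 * ?Q\<close>; hence both attain the bound.\<close>
    with le[of ?u] le[of "- \<i> * ?u"]
    show "(A_norm A (Re_rot ?u))\<^sup>2 = (A_norm A (Re_rot (- \<i> * ?u)))\<^sup>2 \<and>
        (A_norm A (Re_rot (- \<i> * ?u)))\<^sup>2 = 1 / 4 * ?Q"
      by (simp add: norm_mult)
  qed
next
  assume ?R
  then have H: "A_norm A (Re_rot (exp (\<i> * of_real \<theta>))) = sqrt (1 / 4 * ?Q)" for \<theta> :: real
    using A_norm_Re_rot_nonneg unfolding A_Re_scaleC A_Im_scaleC by (metis real_sqrt_unique)
  \<comment> \<open>The angle 0 suffices for the lower bound, as \<open>H\<close> evaluates the left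
    side; the upper bound uses all angles.\<close>
  have "A_norm A (Re_rot 1) \<le> ?w" by (rule A_norm_Re_rot_le_A_numerical_radius) simp
  moreover have "?w \<le> sqrt (1 / 4 * ?Q)"
    by (rule A_numerical_radius_le_A_norm_Re_rot) (simp only: H order_refl)
  ultimately show "?w = sqrt (1 / 4 * ?Q)"
    using H[of 0] by simp
qed

end

end

theorem theorem2p6:
  fixes A T :: "'a::complex_hilbert \<Rightarrow> 'a"
  assumes "positive_op A"
    and "T \<in> A_adjointable A"
  shows "A_numerical_radius A T =
           sqrt (1 / 4 * A_norm A (\<lambda>x. A_sharp A T (T x) + T (A_sharp A T x)))
     \<longleftrightarrow>
         (\<forall>\<theta>::real.
           (A_norm A (A_Re A (\<lambda>x. exp (\<i> * of_real \<theta>) *\<^sub>C T x)))\<^sup>2 =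
             (A_norm A (A_Im A (\<lambda>x. exp (\<i> * of_real \<theta>) *\<^sub>C T x)))\<^sup>2
         \<and> (A_norm A (A_Im A (\<lambda>x. exp (\<i> * of_real \<theta>) *\<^sub>C T x)))\<^sup>2 =
             1 / 4 * A_norm A (\<lambda>x. A_sharp A T (T x) + T (A_sharp A T x)))"
  using positive_operator.A_numerical_radius_eq_iff[OF positive_operator.intro] assms .

end
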